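(* Let $n\ge 2$ be an integer, $T>0$, $\delta\in(0,1)$ and $L(t_0,\dots,t_n)=\sum_{0\le j<i\le n}\delta^{t_i-t_j}$. Let $\bar t=(0,t_1,\dots,t_{n-1},T)$ be such that $\frac{\partial L}{\partial t_k}(\bar t)=0$ for all $k\in\{1,\dots,n-1\}$, and put $T_i=\delta^{t_i}$. Then for all $i\in\{1,\dots,n-1\}$, \[T_i=\frac{T_1^{\,i}}{(1+T_1)^{i-1}}.\] *)

theory Defs
  imports "HOL-Analysis.Analysis"
begin

text \<open>A point \<open>(t 0, \<dots>, t n)\<close> of real \<open>(n+1)\<close>-space is a function \<open>t :: nat \<Rightarrow> real\<close>
  of which only the values at arguments up to \<open>n\<close> enter \<open>L \<delta> n t\<close>.\<close>

definition L :: "real \<Rightarrow> nat \<Rightarrow> (nat \<Rightarrow> real) \<Rightarrow> real" where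
  "L \<delta> n t = (\<Sum>i\<le>n. \<Sum>j<i. \<delta> powr (t i - t j))"

definition partial_deriv :: "((nat \<Rightarrow> real) \<Rightarrow> real) \<Rightarrow> nat \<Rightarrow> (nat \<Rightarrow> real) \<Rightarrow> real" where
  "partial_deriv F k t = deriv (\<lambda>s. F (t(k := s))) (t k)"

end

theory Submission
  imports Defs
begin

text \<open>Write \<open>x\<^sub>i = \<delta>\<^bsup>t\<^sub>i\<^esup>\<close>, \<open>A\<^sub>k = \<Sum>\<^sub>j\<^sub><\<^sub>k 1/x\<^sub>j\<close> and \<open>B\<^sub>k = \<Sum>\<^sub>k\<^sub><\<^sub>i x\<^sub>i\<close>. Criticality in direction \<open>k\<close> means
  \<open>x\<^sub>k\<^sup>2 A\<^sub>k = B\<^sub>k\<close>. Subtracting two consecutive equations, and using the invariant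
  \<open>x\<^sub>k A\<^sub>k = x\<^sub>1\<close>, the ratio \<open>q = x\<^sub>k\<^sub>+\<^sub>1/x\<^sub>k\<close> satisfies \<open>(q + 1)((1 + x\<^sub>1) q - x\<^sub>1) = 0\<close>. As \<open>q > 0\<close>,
  it equals \<open>x\<^sub>1/(1 + x\<^sub>1)\<close>, which also propagates the invariant.\<close>

text \<open>The variable \<open>t k\<close> enters the exponents with slope 1 in the pairs with
  \<open>i = k\<close> and with slope -1 in those with \<open>j = k\<close>, whence the two sums of
  opposite sign.\<close>

lemma partial_deriv_L:
  assumes "0 < \<delta>" "k \<le> n"
  shows "partial_deriv (L \<delta> n) k t =
    ln \<delta> * ((\<Sum>j<k. \<delta> powr (t k - t j)) - (\<Sum>i\<in>{k<..n}. \<delta> powr (t i - t k)))"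
proof -
  let ?e = "\<lambda>i. if i = k then 1 else 0 :: real"
  let ?p = "\<lambda>i j. ln \<delta> * \<delta> powr (t i - t j)"
  have upd: "((\<lambda>s. (t(k := s)) i) has_real_derivative ?e i) (at (t k))" for i
    by simp
  have summand: "((\<lambda>s. \<delta> powr ((t(k := s)) i - (t(k := s)) j)) has_real_derivative
      ?p i j * (?e i - ?e j)) (at (t k))" for i j
  proof -
    have "((\<lambda>s. exp (((t(k := s)) i - (t(k := s)) j) * ln \<delta>)) has_real_derivative
      exp (((t(k := t k)) i - (t(k := t k)) j) * ln \<delta>) * ((?e i - ?e j) * ln \<delta>)) (at (t k))"
      by (intro DERIV_fun_exp DERIV_cmult_right DERIV_diff upd)
    then show ?thesis
      using \<open>0 < \<delta>\<close> by (simp add: powr_def mult_ac)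
  qed
  have "((\<lambda>s. L \<delta> n (t(k := s))) has_real_derivative
      (\<Sum>i\<le>n. \<Sum>j<i. ?p i j * (?e i - ?e j))) (at (t k))"
    unfolding L_def by (intro DERIV_sum summand)
  then have "partial_deriv (L \<delta> n) k t = (\<Sum>i\<le>n. \<Sum>j<i. ?p i j * (?e i - ?e j))"
    unfolding partial_deriv_def by (rule DERIV_imp_deriv)
  \<comment> \<open>In the inner sum \<open>?e i\<close> is constant, while \<open>?e j\<close>
    selects the term \<open>j = k\<close>, present only if \<open>k < i\<close>.\<close>
  also have "\<dots> = (\<Sum>i\<le>n. (if i = k then \<Sum>j<i. ?p i j else 0) - (if k < i then ?p i k else 0))"
  proof (intro sum.cong refl)
    fix i
    have "(\<Sum>j<i. ?p i j * (?e i - ?e j))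
        = (\<Sum>j<i. ?p i j * ?e i) - (\<Sum>j<i. if j = k then ?p i j else 0)"
      by (simp add: right_diff_distrib sum_subtractf if_distrib cong: if_cong)
    also have "\<dots> = (if i = k then \<Sum>j<i. ?p i j else 0) - (if k < i then ?p i k else 0)"
      by simp
    finally show "(\<Sum>j<i. ?p i j * (?e i - ?e j))
        = (if i = k then \<Sum>j<i. ?p i j else 0) - (if k < i then ?p i k else 0)" .
  qed
  also have "\<dots> = (\<Sum>j<k. ?p k j) - (\<Sum>i\<in>{i \<in> {..n}. k < i}. ?p i k)"
  proof -
    have "k \<in> {..n}"
      using \<open>k \<le> n\<close> by simp
    then show ?thesis
      by (simp add: sum_subtractf sum.inter_filter del: atMost_iff)
  qed
  also have "{i \<in> {..n}. k < i} = {k<..n}"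
    by auto
  finally show ?thesis
    by (simp add: right_diff_distrib sum_distrib_left)
qed

text \<open>As \<open>ln \<delta>\<close> is nonzero, the two sums in the derivative agree; pulling
  \<open>\<delta> powr t k\<close> out of each clears the differences in the exponents.\<close>

lemma critical_equation:
  assumes "0 < \<delta>" "\<delta> < 1" "k \<le> n" "partial_deriv (L \<delta> n) k t = 0"
  shows "(\<delta> powr t k)\<^sup>2 * (\<Sum>j<k. 1 / \<delta> powr t j) = (\<Sum>i\<in>{k<..n}. \<delta> powr t i)"
proof -
  have "(\<Sum>j<k. \<delta> powr (t k - t j)) = (\<Sum>i\<in>{k<..n}. \<delta> powr (t i - t k))"
    using assms partial_deriv_L[of \<delta> k n t] by simp
  then have "\<delta> powr t k * (\<Sum>j<k. 1 / \<delta> powr t j) = (\<Sum>i\<in>{k<..n}. \<delta> powr t i) / \<delta> powr t k"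
    by (simp add: powr_diff sum_distrib_left sum_divide_distrib)
  then show ?thesis
    using \<open>0 < \<delta>\<close> by (simp add: power2_eq_square field_simps)
qed

text \<open>Used with \<open>x\<close>, \<open>y\<close>, \<open>z\<close> as
  \<open>x\<^sub>1\<close>, \<open>x\<^sub>k\<close>, \<open>x\<^sub>k\<^sub>+\<^sub>1\<close>, and
  \<open>A\<close>, \<open>B\<close> as \<open>A\<^sub>k\<close>,
  \<open>B\<^sub>k\<^sub>+\<^sub>1\<close>; then \<open>A + 1 / y\<close> is
  \<open>A\<^sub>k\<^sub>+\<^sub>1\<close>.\<close>

lemma critical_ratio:
  fixes x y z A B :: real
  assumes pos: "0 < x" "0 < y" "0 < z"
    and inv: "y * A = x"
    and eqs: "y\<^sup>2 * A = B + z" "z\<^sup>2 * (A + 1 / y) = B"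
  shows "z = y * (x / (1 + x))" and "z * (A + 1 / y) = x"
proof -
  have "A = x / y"
    using pos inv by (simp add: field_simps)
  with eqs pos have "y * x = z\<^sup>2 * ((x + 1) / y) + z"
    by (simp add: power2_eq_square add_divide_distrib)
  then have "y\<^sup>2 * x = z\<^sup>2 * (x + 1) + z * y"
    using pos by (simp add: field_simps power2_eq_square)
  then have "(z + y) * (z * (1 + x) - y * x) = 0"
    by (simp add: algebra_simps power2_eq_square)
  then have *: "z * (1 + x) = y * x"
    using pos by simp
  then show "z = y * (x / (1 + x))"
    using pos by (simp add: field_simps)
  show "z * (A + 1 / y) = x"
    using * pos \<open>A = x / y\<close> by (simp add: field_simps)
qed

theorem theorem2:
  fixes n :: nat and T \<delta> :: real and t :: "nat \<Rightarrow> real"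
  assumes "n \<ge> 2" and "T > 0" and "0 < \<delta>" and "\<delta> < 1"
    and "t 0 = 0" and "t n = T"
    and "\<forall>k\<in>{1..n-1}. partial_deriv (L \<delta> n) k t = 0"
  shows "\<forall>i\<in>{1..n-1}. \<delta> powr t i = (\<delta> powr t 1) ^ i / (1 + \<delta> powr t 1) ^ (i - 1)"
proof -
  define x where "x i = \<delta> powr t i" for i
  define A where "A k = (\<Sum>j<k. 1 / x j)" for k
  have pos: "0 < x i" for i
    using \<open>0 < \<delta>\<close> by (simp add: x_def)
  have crit: "(x k)\<^sup>2 * A k = (\<Sum>i\<in>{k<..n}. x i)" if "1 \<le> k" "k \<le> n - 1" for k
    using critical_equation[of \<delta> k n t] assms that by (simp add: x_def A_def)
  \<comment> \<open>With \<open>i = Suc m\<close> the exponent \<open>i - 1\<close> becomes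
    \<open>m\<close>; the second conjunct is the invariant that the induction carries along.\<close>
  have "x (Suc m) = x 1 ^ Suc m / (1 + x 1) ^ m \<and> x (Suc m) * A (Suc m) = x 1"
    if "Suc m \<le> n - 1" for m
    using that
  proof (induction m)
    case 0
    \<comment> \<open>Here \<open>t 0 = 0\<close> enters: \<open>A 1 = 1 / x 0 = 1\<close>.\<close>
    show ?case
      using assms by (simp add: A_def x_def)
  next
    case (Suc m)
    let ?k = "Suc m"
    have IH: "x ?k = x 1 ^ ?k / (1 + x 1) ^ m" "x ?k * A ?k = x 1"
      using Suc by auto
    \<comment> \<open>Splitting off the first term of the tail sum lets the equations at
      \<open>?k\<close> and \<open>Suc ?k\<close> share the same remainder.\<close>
    have "{?k<..n} = insert (Suc ?k) {Suc ?k<..n}"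
      using Suc.prems by auto
    then have "(x ?k)\<^sup>2 * A ?k = (\<Sum>i\<in>{Suc ?k<..n}. x i) + x (Suc ?k)"
      using crit[of ?k] Suc.prems by simp
    moreover have "(x (Suc ?k))\<^sup>2 * (A ?k + 1 / x ?k) = (\<Sum>i\<in>{Suc ?k<..n}. x i)"
      using crit[of "Suc ?k"] Suc.prems by (simp add: A_def)
    ultimately have "x (Suc ?k) = x ?k * (x 1 / (1 + x 1))"
      and "x (Suc ?k) * (A ?k + 1 / x ?k) = x 1"
      using critical_ratio[OF pos pos pos IH(2)] by blast+
    then show ?case
      by (simp add: IH(1) A_def mult_ac)
  qed
  from this[of "i - 1" for i]
  have "x i = x 1 ^ i / (1 + x 1) ^ (i - 1)" if "i \<in> {1..n-1}" for i
    using that by (metis Suc_diff_1 atLeastAtMost_iff less_eq_Suc_le One_nat_def)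
  then show ?thesis
    unfolding x_def by blast
qed

end
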